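(* For every connected graph $G$ with $n$ vertices, there exists a quasipolynomial $f(m)$ of degree $n$ such that $\hbar_G(m)=f(m)$. Further, $\hbar_G(m)$ has (constant) leading coefficient $1$ and $|\hbar_G(-1)|=2^n-2$.
   Context: A graph $G=(V,E)$ has a finite vertex set $V=\{x_1,\dots,x_n\}$ and an edge set $E$ that is a collection of $2$-element subsets of $V$. For a positive integer $m$, an $m$-coloring of $G$ is a labeling $c$ of the vertices of $G$ with values from $\{1,\dots,m\}$. An $m$-coloring $c$ is nowhere harmonic if for every vertex $v$ of $G$, the value $c(v)$ is not equal to the average value of $c(w)$, where the average is taken over all $w$ that are neighbors of $v$. For $m\ge 1$, $\hbar_G(m)$ denotes the number of nowhere-harmonic $m$-colorings of $G$. A quasipolynomial is a function $f(m)$ defined on $\mathbb{Z}$ such that there exist a positive integer $k$ and polynomials $p_1(m),\dots,p_k(m)$ such that $f(m)=p_j(m)$ whenever $m\equiv j \bmod k$. The value $\hbar_G(-1)$ means the value at $-1$ of the quasipolynomial $f$ that agrees with $\hbar_G$ at the positive integers.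
   Formalization: The graph is assumed to have n ≥ 2 vertices: for n = 1 the average over the neighbors is undefined and the claim fails under any convention (e.g. the count is m, with absolute value 1 at −1 rather than 2^1−2 = 0), and for n = 0 the value 2^0−2 is negative. *)

theory Defs
  imports Complex_Main "HOL-Library.FuncSet" "HOL-Number_Theory.Cong"
    "HOL-Computational_Algebra.Polynomial"
begin

definition finite_graph :: "'a set \<Rightarrow> 'a set set \<Rightarrow> bool" where
  "finite_graph V E \<longleftrightarrow> finite V \<and> (\<forall>e\<in>E. e \<subseteq> V \<and> card e = 2)"

definition neighbors :: "'a set set \<Rightarrow> 'a \<Rightarrow> 'a set" where
  "neighbors E v = {w. {v, w} \<in> E \<and> w \<noteq> v}"

definition connected_graph :: "'a set \<Rightarrow> 'a set set \<Rightarrow> bool" where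
  "connected_graph V E \<longleftrightarrow>
     V \<noteq> {} \<and> (\<forall>v\<in>V. \<forall>w\<in>V. (v, w) \<in> {(x, y). y \<in> neighbors E x}\<^sup>*)"

definition colorings :: "'a set \<Rightarrow> nat \<Rightarrow> ('a \<Rightarrow> nat) set" where
  "colorings V m = V \<rightarrow>\<^sub>E {1..m}"

definition average :: "('a \<Rightarrow> nat) \<Rightarrow> 'a set \<Rightarrow> real" where
  "average c W = (\<Sum>w\<in>W. real (c w)) / real (card W)"

text \<open>The average over the empty set is \<open>0\<close> here, by the library convention for division;
  it only arises at isolated vertices.\<close>

definition nowhere_harmonic :: "'a set \<Rightarrow> 'a set set \<Rightarrow> ('a \<Rightarrow> nat) \<Rightarrow> bool" where
  "nowhere_harmonic V E c \<longleftrightarrow> (\<forall>v\<in>V. real (c v) \<noteq> average c (neighbors E v))"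

definition hbar :: "'a set \<Rightarrow> 'a set set \<Rightarrow> nat \<Rightarrow> nat" where
  "hbar V E m = card {c \<in> colorings V m. nowhere_harmonic V E c}"

definition constituents :: "(int \<Rightarrow> real) \<Rightarrow> nat \<Rightarrow> (nat \<Rightarrow> real poly) \<Rightarrow> bool" where
  "constituents f k p \<longleftrightarrow> k > 0 \<and>
     (\<forall>j\<in>{1..k}. \<forall>m. [m = int j] (mod int k) \<longrightarrow> f m = poly (p j) (of_int m))"

definition quasipolynomial :: "(int \<Rightarrow> real) \<Rightarrow> bool" where
  "quasipolynomial f \<longleftrightarrow> (\<exists>k p. constituents f k p)"

text \<open>A quasipolynomial determines its constituents once the period \<open>k\<close> is chosen, and replacing
  \<open>k\<close> by a multiple only repeats them.  Hence the degree (the largest degree of a constituent)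
  and the leading coefficient (the coefficient in that degree, as a function of the residue class)
  do not depend on the representation, and quantifying existentially over it is harmless.\<close>

definition max_degree :: "nat \<Rightarrow> (nat \<Rightarrow> real poly) \<Rightarrow> nat" where
  "max_degree k p = Max ((\<lambda>j. degree (p j)) ` {1..k})"

definition has_degree :: "(int \<Rightarrow> real) \<Rightarrow> nat \<Rightarrow> bool" where
  "has_degree f d \<longleftrightarrow> (\<exists>k p. constituents f k p \<and> max_degree k p = d)"

definition has_constant_lead_coeff :: "(int \<Rightarrow> real) \<Rightarrow> real \<Rightarrow> bool" where
  "has_constant_lead_coeff f a \<longleftrightarrow>
     (\<exists>k p. constituents f k p \<and> (\<forall>j\<in>{1..k}. coeff (p j) (max_degree k p) = a))"

end

theory Submission
  imports Defs
begin

text \<open>Expand by inclusion-exclusion over the sets \<open>A \<subseteq> V\<close> of vertices at which a coloring is required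
  to be harmonic: \<open>hbar\<close> is the sum over \<open>A\<close> of \<open>(-1) ^ card A\<close> times the number of colorings harmonic on
  \<open>A\<close> (\<open>hbar_inclusion_exclusion\<close>).  Each of these numbers can be computed directly, without
  Ehrhart theory.

  Let \<open>A \<noteq> V\<close> and call \<open>S = V - A\<close> the boundary.  By the maximum principle, which needs
  connectedness, a function harmonic on \<open>A\<close> is determined by its values on \<open>S\<close>, and if these lie
  between \<open>1\<close> and \<open>m\<close> then so do all its values.  So the colorings harmonic on \<open>A\<close> correspond to
  the points of the box \<open>{1..m}\<close> to the power \<open>S\<close> whose harmonic extension is integral
  (\<open>card_harmonic_colorings_eq_extendable\<close>).  For a suitable \<open>D > 0\<close>, integrality of the extension
  depends only on the boundary values modulo \<open>D\<close> (\<open>extendable_periodic\<close>).  The count is therefore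
  a sum, over the admissible residue vectors \<open>r\<close> with entries in \<open>{1..D}\<close>, of the products of
  \<open>\<lfloor>(m + D - r s) / D\<rfloor>\<close> over \<open>s \<in> S\<close>.  This is a quasipolynomial of degree at most \<open>|S|\<close>.  At
  \<open>m = -1\<close> a factor is \<open>-1\<close> if \<open>r s = D\<close> and \<open>0\<close> otherwise, so only the vector with all entries
  \<open>D\<close> contributes.  It is admissible since it is congruent to \<open>0\<close>, and the value is
  \<open>(-1) ^ card S\<close> (\<open>card_periodic_box_quasipolynomial\<close>).

  For \<open>A = V\<close> only the \<open>m\<close> constant colorings remain, with value \<open>-1\<close> at \<open>m = -1\<close>.

  Only \<open>A = {}\<close> reaches degree \<open>n\<close>, with the polynomial \<open>m ^ n\<close>; hence the degree and the leading
  coefficient.  At \<open>-1\<close> each of the \<open>2 ^ n - 1\<close> proper subsets contributes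
  \<open>(-1) ^ card A * (-1) ^ card S = (-1) ^ n\<close>, while \<open>V\<close> contributes \<open>- (-1) ^ n\<close>, for a total of
  \<open>(-1) ^ n (2 ^ n - 2)\<close>.\<close>

section \<open>Periodic conditions on points of a box\<close>

text \<open>Expand the product over \<open>v\<close> of \<open>1 - [H c v]\<close>, which is the indicator of avoiding all conditions,
  and exchange the two sums.\<close>

lemma card_avoiding_inclusion_exclusion:
  fixes H :: "'c \<Rightarrow> 'v \<Rightarrow> bool"
  assumes "finite C" "finite V"
  shows "real (card {c \<in> C. \<forall>v\<in>V. \<not> H c v}) =
    (\<Sum>A\<in>Pow V. (-1) ^ card A * real (card {c \<in> C. \<forall>v\<in>A. H c v}))"
proof -
  have ind: "(\<Prod>v\<in>A. of_bool (P v)) = (of_bool (\<forall>v\<in>A. P v) :: real)" if "finite A"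
    for A and P :: "'v \<Rightarrow> bool"
    using that by (induction A rule: finite_induct) auto
  have cnt: "real (card {c \<in> C. P c}) = (\<Sum>c\<in>C. of_bool (P c))" for P
    using assms(1) by (simp add: of_bool_def sum.If_cases Int_def)
  have expand: "of_bool (\<forall>v\<in>V. \<not> H c v) =
      (\<Sum>A\<in>Pow V. (-1) ^ card A * (of_bool (\<forall>v\<in>A. H c v) :: real))" for c
  proof -
    have "of_bool (\<forall>v\<in>V. \<not> H c v) = (\<Prod>v\<in>V. (1::real) - of_bool (H c v))"
      using assms(2) by (simp add: ind[symmetric] of_bool_not_iff)
    also have "\<dots> = (\<Sum>A\<in>Pow V. (-1) ^ card A * (\<Prod>v\<in>A. of_bool (H c v)) * (\<Prod>v\<in>V-A. 1))"
      by (rule prod_diff_conv_sum[OF assms(2)])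
    also have "\<dots> = (\<Sum>A\<in>Pow V. (-1) ^ card A * (of_bool (\<forall>v\<in>A. H c v) :: real))"
      using assms(2) by (intro sum.cong refl) (auto simp: ind finite_subset)
    finally show ?thesis .
  qed
  show ?thesis
    unfolding cnt expand sum_distrib_left by (rule sum.swap)
qed

text \<open>The representative \<open>r\<close> is taken from \<open>{1..D}\<close> rather than \<open>{0..<D}\<close> because counting starts at
  \<open>1\<close>: then a single floor expression is correct for every \<open>m\<close>.\<close>

lemma card_residue_class:
  fixes D r m :: nat
  assumes "1 \<le> r" "r \<le> D"
  shows "card {x \<in> {1..m}. [x = r] (mod D)} = (m + D - r) div D"
proof (induction m)
  case 0
  then show ?case using assms by simp
next
  case (Suc m)
  have zero_iff: "(Suc m + D - r) mod D = 0 \<longleftrightarrow> [Suc m = r] (mod D)"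
  proof -
    have "(Suc m + D - r) mod D = 0 \<longleftrightarrow> [Suc m + D = r] (mod D)"
      using assms by (subst cong_diff_iff_cong_0_nat[symmetric]) (auto simp: cong_def)
    moreover have "(Suc m + D) mod D = Suc m mod D" by (rule mod_add_self2)
    ultimately show ?thesis unfolding cong_def by metis
  qed
  have "{x \<in> {1..Suc m}. [x = r] (mod D)} =
      {x \<in> {1..m}. [x = r] (mod D)} \<union> (if [Suc m = r] (mod D) then {Suc m} else {})"
    by (auto simp: le_Suc_eq)
  moreover have "finite {x \<in> {1..m}. [x = r] (mod D)}"
    "Suc m \<notin> {x \<in> {1..m}. [x = r] (mod D)}" by auto
  ultimately have "card {x \<in> {1..Suc m}. [x = r] (mod D)} =
      (m + D - r) div D + (if [Suc m = r] (mod D) then 1 else 0)"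
    using Suc.IH by (cases "[Suc m = r] (mod D)") (simp_all del: atLeastAtMost_iff mem_Collect_eq)
  also have "\<dots> = (Suc m + D - r) div D"
    using zero_iff assms by (auto simp: div_Suc Suc_diff_le)
  finally show ?case .
qed

text \<open>Each point of the box is congruent to exactly one vector \<open>r\<close> with entries in \<open>{1..D}\<close>, and
  \<open>P\<close> passes between the two.  The points congruent to a given \<open>r\<close> form a product of residue
  classes.\<close>

lemma card_periodic_box:
  fixes S :: "'a set" and D m :: nat
  assumes "finite S" "D > 0"
    and periodic: "\<And>u u'. P u \<Longrightarrow> (\<And>s. s \<in> S \<Longrightarrow> [u' s = u s] (mod D)) \<Longrightarrow> P u'"
  shows "card {u \<in> S \<rightarrow>\<^sub>E {1..m}. P u} =
    (\<Sum>r\<in>{r \<in> S \<rightarrow>\<^sub>E {1..D}. P r}. \<Prod>s\<in>S. (m + D - r s) div D)"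
proof -
  define R where "R = {r \<in> S \<rightarrow>\<^sub>E {1..D}. P r}"
  define box where "box r = (\<Pi>\<^sub>E s\<in>S. {x \<in> {1..m}. [x = r s] (mod D)})" for r :: "'a \<Rightarrow> nat"
  have finR: "finite R"
    by (rule finite_subset[of _ "S \<rightarrow>\<^sub>E {1..D}"])
      (use assms(1) in \<open>auto simp: R_def intro!: finite_PiE\<close>)
  have unique: "r s = r' s"
    if "r \<in> R" "r' \<in> R" "s \<in> S" "[r s = r' s] (mod D)" for r r' s
  proof -
    have b: "r s \<in> {1..D}" "r' s \<in> {1..D}" using that unfolding R_def by auto
    from that(4) have "[int (r s) = int (r' s)] (mod int D)" by (simp add: cong_int_iff)
    then have "int D dvd int (r s) - int (r' s)" by (simp add: cong_iff_dvd_diff)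
    moreover have "\<bar>int (r s) - int (r' s)\<bar> < int D" using b by auto
    ultimately have "int (r s) - int (r' s) = 0" 
      using dvd_imp_le_int[of "int (r s) - int (r' s)" "int D"] by linarith
    then show ?thesis by simp
  qed
  have eq: "{u \<in> S \<rightarrow>\<^sub>E {1..m}. P u} = (\<Union>r\<in>R. box r)"
  proof (intro equalityI subsetI)
    fix u assume u: "u \<in> {u \<in> S \<rightarrow>\<^sub>E {1..m}. P u}"
    \<comment> \<open>the representative of \<open>u s\<close> in \<open>{1..D}\<close>: shift by one before and after reducing; adding
        \<open>D - 1\<close> in place of subtracting \<open>1\<close> avoids truncation\<close>
    define r where "r = (\<lambda>s\<in>S. (u s + (D - 1)) mod D + 1)"
    have c: "[u s = r s] (mod D)" if "s \<in> S" for s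
    proof -
      have "r s = (u s + (D - 1)) mod D + 1" using that by (simp add: r_def)
      also have "[\<dots> = u s + (D - 1) + 1] (mod D)"
        by (intro cong_add) (auto simp: cong_def)
      also have "u s + (D - 1) + 1 = u s + D" using assms(2) by simp
      also have "[u s + D = u s] (mod D)" by (simp add: cong_def)
      finally show ?thesis by (rule cong_sym)
    qed
    have "P r" using u c by (intro periodic[of u r]) (auto simp: cong_sym)
    moreover have "r \<in> S \<rightarrow>\<^sub>E {1..D}"
      using assms(2) by (auto simp: r_def Suc_le_eq)
    ultimately have "r \<in> R" by (simp add: R_def)
    moreover have "u \<in> box r" using u c unfolding box_def by auto
    ultimately show "u \<in> (\<Union>r\<in>R. box r)" by blast
  next
    fix u assume "u \<in> (\<Union>r\<in>R. box r)"
    then obtain r where r: "r \<in> R" "u \<in> box r" by blast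
    have "P u" using r by (intro periodic[of r u]) (auto simp: R_def box_def)
    then show "u \<in> {u \<in> S \<rightarrow>\<^sub>E {1..m}. P u}" using r by (auto simp: box_def PiE_iff)
  qed
  have "box r \<inter> box r' = {}" if "r \<in> R" "r' \<in> R" "r \<noteq> r'" for r r'
  proof (rule ccontr)
    assume "box r \<inter> box r' \<noteq> {}"
    then obtain u where "u \<in> box r" "u \<in> box r'" by blast
    then have "r s = r' s" if "s \<in> S" for s
      using \<open>r \<in> R\<close> \<open>r' \<in> R\<close> that
      by (intro unique) (auto simp: box_def PiE_iff cong_def)
    then have "r = r'" using \<open>r \<in> R\<close> \<open>r' \<in> R\<close> unfolding R_def
      by (intro PiE_ext[of r S "\<lambda>_. {1..D}" r']) auto
    with that show False by blast
  qed
  then have "card (\<Union>r\<in>R. box r) = (\<Sum>r\<in>R. card (box r))"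
    using finR assms(1) by (intro card_UN_disjoint) (auto simp: box_def intro!: finite_PiE)
  also have "\<dots> = (\<Sum>r\<in>R. \<Prod>s\<in>S. (m + D - r s) div D)"
  proof (rule sum.cong[OF refl])
    fix r assume "r \<in> R"
    then have "1 \<le> r s \<and> r s \<le> D" if "s \<in> S" for s using that by (auto simp: R_def)
    then show "card (box r) = (\<Prod>s\<in>S. (m + D - r s) div D)"
      unfolding box_def card_PiE[OF assms(1)] by (intro prod.cong refl card_residue_class) auto
  qed
  finally show ?thesis unfolding eq R_def .
qed

text \<open>The floor expression for the size of a residue class makes sense for every integer \<open>m\<close> and is
  affine in \<open>m\<close> on each class modulo \<open>D\<close>, so it extends the count to a quasipolynomial.  The
  condition at \<open>0\<close> says that the residue vector with all entries \<open>D\<close> is admissible; at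
  \<open>m = -1\<close> it is the only one with a nonzero product.\<close>

lemma card_periodic_box_quasipolynomial:
  fixes S :: "'a set" and D :: nat
  assumes "finite S" "D > 0"
    and periodic: "\<And>u u'. P u \<Longrightarrow> (\<And>s. s \<in> S \<Longrightarrow> [u' s = u s] (mod D)) \<Longrightarrow> P u'"
    and zero: "P (\<lambda>_. 0)"
  shows "\<exists>g p. constituents g D p \<and> (\<forall>j. degree (p j) \<le> card S) \<and>
    (\<forall>m. g (int m) = real (card {u \<in> S \<rightarrow>\<^sub>E {1..m}. P u})) \<and> g (-1) = (-1) ^ card S"
proof -
  define R where "R = {r \<in> S \<rightarrow>\<^sub>E {1..D}. P r}"
  define g :: "int \<Rightarrow> real" where
    "g = (\<lambda>m. \<Sum>r\<in>R. \<Prod>s\<in>S. of_int ((m + int D - int (r s)) div int D))"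
  \<comment> \<open>for \<open>m\<close> congruent to \<open>j\<close>, the floor at \<open>m\<close> is the floor at \<open>j\<close> plus \<open>(m - j) / D\<close>\<close>
  define p :: "nat \<Rightarrow> real poly" where
    "p = (\<lambda>j. \<Sum>r\<in>R. \<Prod>s\<in>S.
      [: of_int ((int j + int D - int (r s)) div int D) - of_nat j / of_nat D, 1 / of_nat D :])"
  have finR: "finite R"
    by (rule finite_subset[of _ "S \<rightarrow>\<^sub>E {1..D}"])
      (use assms(1) in \<open>auto simp: R_def intro!: finite_PiE\<close>)
  have "constituents g D p"
    unfolding constituents_def
  proof (intro conjI ballI allI impI)
    show "D > 0" by fact
  next
    fix j m assume "[m = int j] (mod int D)"
    then obtain k where k: "m = int j + int D * k"
      by (metis cong_iff_lin cong_sym)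
    have "(m + int D - i) div int D = (int j + int D - i) div int D + k" for i
    proof -
      have "m + int D - i = (int j + int D - i) + k * int D" using k by simp
      then show ?thesis using assms(2) by (simp only: div_mult_self1)
    qed
    moreover have "real_of_int m / real D = real j / real D + real_of_int k"
      using assms(2) by (simp add: k field_simps)
    ultimately show "g m = poly (p j) (of_int m)"
      by (simp add: g_def p_def poly_sum poly_prod algebra_simps)
  qed
  moreover have "degree (p j) \<le> card S" for j
    unfolding p_def
  proof (rule degree_sum_le[OF finR])
    fix r assume "r \<in> R"
    show "degree (\<Prod>s\<in>S. [: of_int ((int j + int D - int (r s)) div int D) - of_nat j / of_nat D,
        1 / of_nat D :] :: real poly) \<le> card S"
      by (rule order_trans[OF degree_prod_sum_le[OF assms(1)]])
        (simp add: assms(2))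
  qed
  moreover have "g (int m) = real (card {u \<in> S \<rightarrow>\<^sub>E {1..m}. P u})" for m
  proof -
    have "(int m + int D - int (r s)) div int D = int ((m + D - r s) div D)"
      if "r \<in> R" "s \<in> S" for r s
    proof -
      have "r s \<le> D" using that by (auto simp: R_def)
      then show ?thesis by (simp add: zdiv_int of_nat_diff)
    qed
    then have "g (int m) = real (\<Sum>r\<in>R. \<Prod>s\<in>S. (m + D - r s) div D)"
      by (simp add: g_def)
    moreover have "card {u \<in> S \<rightarrow>\<^sub>E {1..m}. P u} = (\<Sum>r\<in>R. \<Prod>s\<in>S. (m + D - r s) div D)"
      unfolding R_def using assms(1,2) periodic by (rule card_periodic_box)
    ultimately show ?thesis by simp
  qed
  moreover have "g (-1) = (-1) ^ card S"
  proof -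
    define top where "top = (\<lambda>s\<in>S. D)"
    have "P top" by (rule periodic[OF zero]) (simp add: top_def cong_def)
    then have top: "top \<in> R" using assms(2) by (auto simp: R_def top_def)
    have factor: "(-1 + int D - int (r s)) div int D = (if r s = D then -1 else 0)"
      if "r \<in> R" "s \<in> S" for r s
    proof -
      have "1 \<le> r s" "r s \<le> D" using that by (auto simp: R_def)
      then show ?thesis using assms(2) by (auto simp: zdiv_eq_0_iff div_eq_minus1)
    qed
    have "(\<Prod>s\<in>S. real_of_int ((-1 + int D - int (r s)) div int D)) =
        (if r = top then (-1) ^ card S else 0)" if r: "r \<in> R" for r
    proof (cases "r = top")
      case True
      then show ?thesis using factor[OF top] by (simp add: top_def)
    next
      case False
      then obtain s where "s \<in> S" "r s \<noteq> D"
        using r PiE_ext[of r S "\<lambda>_. {1..D}" top] top unfolding R_def top_def by force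
      then have "\<exists>s\<in>S. real_of_int ((-1 + int D - int (r s)) div int D) = 0"
        using factor[OF r] by auto
      then show ?thesis using False assms(1) by (simp add: prod_zero)
    qed
    then have "g (-1) = (\<Sum>r\<in>R. if r = top then (-1) ^ card S else 0)"
      by (simp add: g_def)
    also have "\<dots> = (-1) ^ card S" using top finR by simp
    finally show ?thesis .
  qed
  ultimately show ?thesis by blast
qed

section \<open>Homogeneous linear systems over a domain\<close>

text \<open>Gaussian elimination without division: pick a variable \<open>l\<close> with nonzero coefficient in equation
  \<open>i\<close>, cross-multiply to remove it from the other equations, solve those, and scale the solution
  by \<open>a i l\<close> so that equation \<open>i\<close> can be solved for the variable \<open>l\<close> inside the ring.\<close>

lemma nontrivial_solution_homogeneous_system:
  fixes a :: "'i \<Rightarrow> 'j \<Rightarrow> 'k::idom"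
  assumes "finite I" "finite J" "card I < card J"
  shows "\<exists>x. (\<exists>j\<in>J. x j \<noteq> 0) \<and> (\<forall>i\<in>I. (\<Sum>j\<in>J. a i j * x j) = 0)"
  using assms
proof (induction I arbitrary: J a rule: finite_induct)
  case empty
  then obtain j where "j \<in> J" by fastforce
  then show ?case by (intro exI[of _ "\<lambda>_. 1"]) auto
next
  case (insert i I)
  show ?case
  proof (cases "\<forall>j\<in>J. a i j = 0")
    case True
    have "card I < card J" using insert by simp
    then obtain x where "\<exists>j\<in>J. x j \<noteq> 0" "\<forall>k\<in>I. (\<Sum>j\<in>J. a k j * x j) = 0"
      using insert.IH[OF insert.prems(1)] by blast
    then show ?thesis using True by (intro exI[of _ x]) auto
  next
    case False
    then obtain l where l: "l \<in> J" "a i l \<noteq> 0" by blast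
    define K where "K = J - {l}"
    have K: "finite K" "l \<notin> K" "J = insert l K" using insert.prems l by (auto simp: K_def)
    then have "card I < card K" using insert by simp
    then obtain y where y: "\<exists>j\<in>K. y j \<noteq> 0"
      "\<forall>k\<in>I. (\<Sum>j\<in>K. (a i l * a k j - a k l * a i j) * y j) = 0"
      using insert.IH[OF K(1), of "\<lambda>k j. a i l * a k j - a k l * a i j"] by blast
    define x where "x = (\<lambda>j. if j = l then - (\<Sum>j\<in>K. a i j * y j) else a i l * y j)"
    have split: "(\<Sum>j\<in>J. a k j * x j) =
        a i l * (\<Sum>j\<in>K. a k j * y j) - a k l * (\<Sum>j\<in>K. a i j * y j)" for k
    proof -
      have "(\<Sum>j\<in>K. a k j * x j) = (\<Sum>j\<in>K. a i l * (a k j * y j))"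
        using K by (intro sum.cong) (auto simp: x_def)
      then show ?thesis using K by (simp add: x_def sum_distrib_left)
    qed
    have "(\<Sum>j\<in>J. a k j * x j) = 0" if "k \<in> insert i I" for k
    proof (cases "k = i")
      case True
      then show ?thesis by (simp add: split)
    next
      case False
      then have "(\<Sum>j\<in>K. (a i l * a k j - a k l * a i j) * y j) = 0" using that y by simp
      then show ?thesis
        by (simp add: split sum_distrib_left left_diff_distrib sum_subtractf mult.assoc)
    qed
    moreover have "\<exists>j\<in>J. x j \<noteq> 0" using y(1) l K by (auto simp: x_def)
    ultimately show ?thesis by blast
  qed
qed

section \<open>Integer functions harmonic on a set of vertices\<close>

locale nontrivial_connected_graph =
  fixes V :: "'a set" and E :: "'a set set"
  assumes graph: "finite_graph V E" and conn: "connected_graph V E" and two: "card V \<ge> 2"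
begin

lemma finite_V: "finite V"
  using graph by (simp add: finite_graph_def)

lemma neighbors_subset: "neighbors E v \<subseteq> V"
  using graph by (auto simp: neighbors_def finite_graph_def)

lemma finite_neighbors: "finite (neighbors E v)"
  using finite_subset[OF neighbors_subset finite_V] .

text \<open>The form in which connectedness enters the maximum principle.\<close>

lemma neighbors_closed_eq_V:
  assumes "T \<subseteq> V" "T \<noteq> {}" and closed: "\<And>v. v \<in> T \<Longrightarrow> neighbors E v \<subseteq> T"
  shows "T = V"
proof
  show "V \<subseteq> T"
  proof
    fix w assume "w \<in> V"
    obtain v where v: "v \<in> T" using assms by blast
    have "(v, w) \<in> {(x, y). y \<in> neighbors E x}\<^sup>*"
      using conn v \<open>w \<in> V\<close> assms(1) by (auto simp: connected_graph_def)
    then show "w \<in> T" by (induction rule: rtrancl_induct) (use v closed in auto)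
  qed
qed fact

lemma neighbors_nonempty:
  assumes "v \<in> V"
  shows "neighbors E v \<noteq> {}"
proof
  assume "neighbors E v = {}"
  then have "{v} = V" using assms by (intro neighbors_closed_eq_V) auto
  then show False using two by auto
qed

text \<open>The averaging condition with denominators cleared, for integer values: which boundary data have
  an integral harmonic extension is what the count depends on.\<close>

definition harmonic_on :: "'a set \<Rightarrow> ('a \<Rightarrow> int) \<Rightarrow> bool" where
  "harmonic_on A h \<longleftrightarrow> (\<forall>v\<in>A. int (card (neighbors E v)) * h v = (\<Sum>w\<in>neighbors E v. h w))"

lemma harmonic_on_const: "harmonic_on A (\<lambda>_. k)"
  by (simp add: harmonic_on_def)

lemma harmonic_on_add:
  "harmonic_on A h \<Longrightarrow> harmonic_on A h' \<Longrightarrow> harmonic_on A (\<lambda>v. h v + h' v)"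
  by (simp add: harmonic_on_def sum.distrib distrib_left)

lemma harmonic_on_scale: "harmonic_on A h \<Longrightarrow> harmonic_on A (\<lambda>v. k * h v)"
  by (simp add: harmonic_on_def sum_distrib_left[symmetric] mult.left_commute)

lemma harmonic_on_diff:
  "harmonic_on A h \<Longrightarrow> harmonic_on A h' \<Longrightarrow> harmonic_on A (\<lambda>v. h v - h' v)"
  using harmonic_on_add[of A h "\<lambda>v. -1 * h' v"] harmonic_on_scale[of A h' "-1"] by simp

lemma harmonic_on_sum:
  "finite S \<Longrightarrow> (\<And>s. s \<in> S \<Longrightarrow> harmonic_on A (h s)) \<Longrightarrow> harmonic_on A (\<lambda>v. \<Sum>s\<in>S. h s v)"
  by (induction S rule: finite_induct) (simp_all add: harmonic_on_const harmonic_on_add)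

text \<open>Clearing denominators is faithful because no vertex is isolated.\<close>

lemma harmonic_at_iff_average:
  assumes "v \<in> V"
  shows "real (c v) = average c (neighbors E v) \<longleftrightarrow>
    int (card (neighbors E v)) * int (c v) = (\<Sum>w\<in>neighbors E v. int (c w))"
proof -
  have "card (neighbors E v) > 0"
    using neighbors_nonempty[OF assms] finite_neighbors by (simp add: card_gt_0_iff)
  then have "real (c v) = average c (neighbors E v) \<longleftrightarrow>
      real (card (neighbors E v) * c v) = real (\<Sum>w\<in>neighbors E v. c w)"
    by (simp add: average_def field_simps)
  also have "\<dots> \<longleftrightarrow> int (card (neighbors E v) * c v) = int (\<Sum>w\<in>neighbors E v. c w)"
    by (simp only: of_nat_eq_iff)
  finally show ?thesis by simp
qed

text \<open>If the maximum over \<open>V\<close> exceeded the boundary bound, every vertex attaining it would lie in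
  \<open>A\<close>.  There the value is the average over the neighbors, none of which is larger, so all
  neighbors attain the maximum as well.  By connectedness all of \<open>V\<close> would attain it, including the
  boundary, which is nonempty.\<close>

lemma harmonic_max_principle:
  assumes "harmonic_on A h" "A \<subset> V" and bound: "\<And>s. s \<in> V - A \<Longrightarrow> h s \<le> M" and "v \<in> V"
  shows "h v \<le> M"
proof (rule ccontr)
  assume "\<not> h v \<le> M"
  define N where "N = Max (h ` V)"
  define T where "T = {v \<in> V. h v = N}"
  have le: "h w \<le> N" if "w \<in> V" for w using that finite_V by (simp add: N_def)
  have "N > M" using le[OF \<open>v \<in> V\<close>] \<open>\<not> h v \<le> M\<close> by simp
  have "N \<in> h ` V" unfolding N_def using finite_V \<open>v \<in> V\<close> by (intro Max_in) auto
  then have "T \<noteq> {}" by (auto simp: T_def)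
  have "T = V"
  proof (rule neighbors_closed_eq_V)
    show "T \<subseteq> V" by (auto simp: T_def)
    show "T \<noteq> {}" by fact
    fix t assume "t \<in> T"
    then have t: "t \<in> V" "h t = N" by (auto simp: T_def)
    with bound[of t] \<open>N > M\<close> have "t \<in> A" by force
    then have "int (card (neighbors E t)) * h t = (\<Sum>w\<in>neighbors E t. h w)"
      using assms(1) by (simp add: harmonic_on_def)
    then have "(\<Sum>w\<in>neighbors E t. N - h w) = 0"
      by (simp add: t(2) sum_subtractf)
    then have "\<forall>w\<in>neighbors E t. N - h w = 0"
      using le neighbors_subset finite_neighbors
      by (subst (asm) sum_nonneg_eq_0_iff) auto
    then show "neighbors E t \<subseteq> T" using neighbors_subset by (auto simp: T_def)
  qed
  then show False using bound assms(2) \<open>N > M\<close> unfolding T_def by fastforce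
qed

lemma harmonic_min_principle:
  assumes "harmonic_on A h" "A \<subset> V" and "\<And>s. s \<in> V - A \<Longrightarrow> M \<le> h s" and "v \<in> V"
  shows "M \<le> h v"
  using harmonic_max_principle[of A "\<lambda>v. -1 * h v" "- M" v] harmonic_on_scale[OF assms(1), of "-1"]
    assms by simp

lemma harmonic_eq_if_boundary_eq:
  assumes "harmonic_on A h" "harmonic_on A h'" "A \<subset> V"
    and "\<And>s. s \<in> V - A \<Longrightarrow> h s = h' s" and "v \<in> V"
  shows "h v = h' v"
proof -
  have d: "harmonic_on A (\<lambda>v. h v - h' v)" using assms harmonic_on_diff by blast
  have "h v - h' v \<le> 0" 
    by (rule harmonic_max_principle[OF d assms(3) _ assms(5)]) (simp add: assms(4))
  moreover have "0 \<le> h v - h' v" 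
    by (rule harmonic_min_principle[OF d assms(3) _ assms(5)]) (simp add: assms(4))
  ultimately show ?thesis by simp
qed

text \<open>Harmonicity on \<open>A\<close> and vanishing on the boundary except at \<open>s\<close> are \<open>|V| - 1\<close> linear equations in
  \<open>|V|\<close> unknowns with integer coefficients, so they have a nonzero integral solution.  It cannot
  vanish at \<open>s\<close>: otherwise it would vanish on the whole boundary and hence everywhere.\<close>

lemma harmonic_extension_of_boundary_point:
  assumes "A \<subset> V" "s \<in> V - A"
  shows "\<exists>h. harmonic_on A h \<and> h s > 0 \<and> (\<forall>t\<in>V - A - {s}. h t = 0)"
proof -
  \<comment> \<open>row \<open>v\<close>: the graph Laplacian for \<open>v\<close> in \<open>A\<close>, the unit vector for \<open>v\<close> on the boundary\<close>
  define a :: "'a \<Rightarrow> 'a \<Rightarrow> int" where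
    "a = (\<lambda>v w. if v \<in> A then (if w = v then int (card (neighbors E v)) else 0)
      - (if w \<in> neighbors E v then 1 else 0) else (if w = v then 1 else 0))"
  have "card (V - {s}) < card V" using assms finite_V by (intro psubset_card_mono) auto
  then obtain x where x: "\<exists>w\<in>V. x w \<noteq> 0" "\<forall>v\<in>V - {s}. (\<Sum>w\<in>V. a v w * x w) = 0"
    using nontrivial_solution_homogeneous_system[of "V - {s}" V a] finite_V by auto
  have boundary: "x t = 0" if "t \<in> V - A - {s}" for t
  proof -
    have "(\<Sum>w\<in>V. a t w * x w) = (\<Sum>w\<in>V. if w = t then x w else 0)"
      using that by (intro sum.cong) (auto simp: a_def)
    then show ?thesis using x(2) that finite_V by simp
  qed
  have harm: "harmonic_on A x"
    unfolding harmonic_on_def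
  proof
    fix v assume v: "v \<in> A"
    have "(\<Sum>w\<in>V. a v w * x w) =
        (\<Sum>w\<in>V. if w = v then int (card (neighbors E v)) * x w else 0)
        - (\<Sum>w\<in>V. if w \<in> neighbors E v then x w else 0)"
      unfolding sum_subtractf[symmetric] using v by (intro sum.cong) (auto simp: a_def left_diff_distrib)
    also have "(\<Sum>w\<in>V. if w = v then int (card (neighbors E v)) * x w else 0)
        = int (card (neighbors E v)) * x v"
      using v assms finite_V by auto
    also have "(\<Sum>w\<in>V. if w \<in> neighbors E v then x w else 0) = (\<Sum>w\<in>neighbors E v. x w)"
      using finite_V neighbors_subset by (simp add: sum.inter_restrict[symmetric] Int_absorb1)
    finally have "(\<Sum>w\<in>V. a v w * x w) =
        int (card (neighbors E v)) * x v - (\<Sum>w\<in>neighbors E v. x w)" .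
    moreover have "v \<in> V - {s}" using v assms by auto
    ultimately show "int (card (neighbors E v)) * x v = (\<Sum>w\<in>neighbors E v. x w)"
      using x(2) by simp
  qed
  have "x s \<noteq> 0"
  proof
    assume "x s = 0"
    then have "x t = 0" if "t \<in> V - A" for t
      using boundary that by (cases "t = s") auto
    then have "x w = 0" if "w \<in> V" for w
      by (rule harmonic_eq_if_boundary_eq[OF harm harmonic_on_const assms(1) _ that])
    then show False using x(1) by blast
  qed
  then have "sgn (x s) * x s > 0" by (simp add: sgn_if)
  moreover have "harmonic_on A (\<lambda>v. sgn (x s) * x v)" by (rule harmonic_on_scale[OF harm])
  ultimately show ?thesis using boundary by (intro exI[of _ "\<lambda>v. sgn (x s) * x v"]) auto
qed

text \<open>One period serves all sets \<open>A\<close> at once, so that the quasipolynomials for the different terms of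
  the inclusion-exclusion sum can be added constituent by constituent.\<close>

lemma common_extension_period:
  "\<exists>D::nat. D > 0 \<and> (\<forall>A s. A \<subset> V \<longrightarrow> s \<in> V - A \<longrightarrow>
    (\<exists>h. harmonic_on A h \<and> h s = int D \<and> (\<forall>t\<in>V - A - {s}. h t = 0)))"
proof -
  define X where "X = (SIGMA A:{A. A \<subset> V}. V - A)"
  have "finite {A. A \<subset> V}"
    using finite_V by (rule finite_subset[rotated, OF finite_Pow_iff[THEN iffD2]]) auto
  then have finX: "finite X" using finite_V unfolding X_def by auto
  have "\<forall>y\<in>X. \<exists>h. harmonic_on (fst y) h \<and> h (snd y) > 0 \<and> (\<forall>t\<in>V - fst y - {snd y}. h t = 0)"
    using harmonic_extension_of_boundary_point by (auto simp: X_def)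
  then obtain H where H: "\<And>y. y \<in> X \<Longrightarrow> harmonic_on (fst y) (H y) \<and> H y (snd y) > 0 \<and>
      (\<forall>t\<in>V - fst y - {snd y}. H y t = 0)"
    by metis
  define D where "D = (\<Prod>y\<in>X. H y (snd y))"
  have "D > 0" unfolding D_def using H by (intro prod_pos) auto
  have "\<exists>h. harmonic_on A h \<and> h s = D \<and> (\<forall>t\<in>V - A - {s}. h t = 0)"
    if "A \<subset> V" "s \<in> V - A" for A s
  proof -
    have y: "(A, s) \<in> X" using that by (auto simp: X_def)
    then have "H (A, s) s dvd D"
      unfolding D_def using finX by (metis dvd_prodI snd_conv)
    then obtain k where "D = k * H (A, s) s" by (metis dvdE mult.commute)
    then show ?thesis
      using H[OF y] harmonic_on_scale[of A "H (A, s)" k]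
      by (intro exI[of _ "\<lambda>v. k * H (A, s) v"]) auto
  qed
  then show ?thesis using \<open>D > 0\<close> by (intro exI[of _ "nat D"]) auto
qed

section \<open>Colorings harmonic on a prescribed set\<close>

text \<open>Boundary values whose harmonic extension to \<open>V\<close>, in general rational, is integral.\<close>

definition extendable :: "'a set \<Rightarrow> ('a \<Rightarrow> nat) \<Rightarrow> bool" where
  "extendable A u \<longleftrightarrow> (\<exists>h. harmonic_on A h \<and> (\<forall>s\<in>V - A. h s = int (u s)))"

text \<open>Changing boundary values by multiples of \<open>D\<close> changes the harmonic extension by an integral
  combination of the extensions of \<open>D\<close> times the unit vectors.\<close>

lemma extendable_periodic:
  assumes period: "\<And>s. s \<in> V - A \<Longrightarrow>
      \<exists>h. harmonic_on A h \<and> h s = int D \<and> (\<forall>t\<in>V - A - {s}. h t = 0)"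
    and "extendable A u" and cong: "\<And>s. s \<in> V - A \<Longrightarrow> [u' s = u s] (mod D)"
  shows "extendable A u'"
proof -
  obtain h where h: "harmonic_on A h" "\<forall>s\<in>V - A. h s = int (u s)"
    using assms(2) by (auto simp: extendable_def)
  obtain b where b: "\<And>s. s \<in> V - A \<Longrightarrow>
      harmonic_on A (b s) \<and> b s s = int D \<and> (\<forall>t\<in>V - A - {s}. b s t = 0)"
    using period by metis
  have "\<exists>k. int (u' s) = int (u s) + int D * k" if "s \<in> V - A" for s
    using cong[OF that] by (metis cong_iff_lin cong_int_iff cong_sym)
  then obtain k where k: "\<And>s. s \<in> V - A \<Longrightarrow> int (u' s) = int (u s) + int D * k s" by metis
  define h' where "h' = (\<lambda>v. h v + (\<Sum>s\<in>V - A. k s * b s v))"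
  have "harmonic_on A h'"
    unfolding h'_def using finite_V b h
    by (intro harmonic_on_add harmonic_on_sum harmonic_on_scale) auto
  moreover have "h' t = int (u' t)" if t: "t \<in> V - A" for t
  proof -
    have "(\<Sum>s\<in>V - A. k s * b s t) = (\<Sum>s\<in>V - A. if s = t then k s * int D else 0)"
      using b t by (intro sum.cong) auto
    also have "\<dots> = k t * int D" using t finite_V by simp
    finally show ?thesis using h k t by (simp add: h'_def)
  qed
  ultimately show ?thesis by (auto simp: extendable_def)
qed

text \<open>Restriction to the boundary is a bijection.  It is injective by uniqueness of harmonic
  extensions; it is surjective because the maximum and minimum principles keep an extension of
  values in \<open>{1..m}\<close> within \<open>{1..m}\<close>, so the range of colors imposes nothing beyond the boundary.\<close>

lemma card_harmonic_colorings_eq_extendable: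
  assumes "A \<subset> V"
  shows "card {c \<in> colorings V m. harmonic_on A (int \<circ> c)} =
    card {u \<in> (V - A) \<rightarrow>\<^sub>E {1..m}. extendable A u}"
proof -
  have "bij_betw (\<lambda>c. restrict c (V - A)) {c \<in> colorings V m. harmonic_on A (int \<circ> c)}
      {u \<in> (V - A) \<rightarrow>\<^sub>E {1..m}. extendable A u}"
    unfolding bij_betw_def
  proof
    show "inj_on (\<lambda>c. restrict c (V - A)) {c \<in> colorings V m. harmonic_on A (int \<circ> c)}"
    proof (rule inj_onI, clarify)
      fix c c' assume c: "c \<in> colorings V m" "harmonic_on A (int \<circ> c)"
        and c': "c' \<in> colorings V m" "harmonic_on A (int \<circ> c')"
        and eq: "restrict c (V - A) = restrict c' (V - A)"
      have "(int \<circ> c) v = (int \<circ> c') v" if "v \<in> V" for v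
      proof (rule harmonic_eq_if_boundary_eq[OF c(2) c'(2) assms _ that])
        fix s assume "s \<in> V - A"
        then show "(int \<circ> c) s = (int \<circ> c') s" using fun_cong[OF eq, of s] by simp
      qed
      then show "c = c'"
        using PiE_ext[of c V "\<lambda>_. {1..m}" c'] c(1) c'(1) by (simp add: colorings_def)
    qed
    show "(\<lambda>c. restrict c (V - A)) ` {c \<in> colorings V m. harmonic_on A (int \<circ> c)} =
        {u \<in> (V - A) \<rightarrow>\<^sub>E {1..m}. extendable A u}"
    proof (intro equalityI subsetI)
      fix u assume "u \<in> (\<lambda>c. restrict c (V - A)) ` {c \<in> colorings V m. harmonic_on A (int \<circ> c)}"
      then obtain c where c: "c \<in> colorings V m" "harmonic_on A (int \<circ> c)"
        and u: "u = restrict c (V - A)" by blast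
      have "extendable A u"
        unfolding extendable_def using c u by (intro exI[of _ "int \<circ> c"]) simp
      then show "u \<in> {u \<in> (V - A) \<rightarrow>\<^sub>E {1..m}. extendable A u}"
        using c u by (auto simp: colorings_def PiE_iff)
    next
      fix u assume "u \<in> {u \<in> (V - A) \<rightarrow>\<^sub>E {1..m}. extendable A u}"
      then have u: "u \<in> (V - A) \<rightarrow>\<^sub>E {1..m}" and "extendable A u" by auto
      then obtain h where h: "harmonic_on A h" and hu: "\<And>s. s \<in> V - A \<Longrightarrow> h s = int (u s)"
        by (auto simp: extendable_def)
      have "h s \<in> {1..int m}" if "s \<in> V - A" for s
        using u hu[OF that] PiE_mem[OF u that] by simp
      then have bounds: "1 \<le> h v" "h v \<le> int m" if "v \<in> V" for v
        using harmonic_min_principle[OF h assms _ that, of 1]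
          harmonic_max_principle[OF h assms _ that, of "int m"] by auto
      define c where "c = (\<lambda>v\<in>V. nat (h v))"
      have ch: "(int \<circ> c) v = h v" if "v \<in> V" for v
        using bounds[OF that] that by (simp add: c_def)
      have "(\<Sum>w\<in>neighbors E v. (int \<circ> c) w) = (\<Sum>w\<in>neighbors E v. h w)" for v
        using neighbors_subset by (intro sum.cong ch) auto
      then have "harmonic_on A (int \<circ> c)"
        using h assms ch unfolding harmonic_on_def by (metis psubsetD)
      moreover have "c \<in> colorings V m"
        using bounds by (force simp: colorings_def c_def)
      moreover have "u = restrict c (V - A)"
      proof
        fix s show "u s = restrict c (V - A) s"
          using hu[of s] PiE_arb[OF u, of s] by (auto simp: c_def)
      qed
      ultimately show "u \<in> (\<lambda>c. restrict c (V - A)) ` {c \<in> colorings V m. harmonic_on A (int \<circ> c)}"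
        by blast
    qed
  qed
  then show ?thesis by (rule bij_betw_same_card)
qed

text \<open>With a single boundary vertex \<open>s\<close>, the constant function \<open>h s\<close> is the harmonic extension.\<close>

lemma harmonic_on_V_iff_constant:
  "harmonic_on V h \<longleftrightarrow> (\<exists>k. \<forall>v\<in>V. h v = k)"
proof
  assume h: "harmonic_on V h"
  obtain s where s: "s \<in> V" using conn by (auto simp: connected_graph_def)
  have h': "harmonic_on (V - {s}) h" using h by (simp add: harmonic_on_def)
  have "h v = h s" if "v \<in> V" for v
    by (rule harmonic_eq_if_boundary_eq[OF h' harmonic_on_const _ _ that]) (use s in auto)
  then show "\<exists>k. \<forall>v\<in>V. h v = k" by blast
next
  assume "\<exists>k. \<forall>v\<in>V. h v = k"
  then obtain k where k: "\<And>v. v \<in> V \<Longrightarrow> h v = k" by blast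
  have "(\<Sum>w\<in>neighbors E v. h w) = (\<Sum>w\<in>neighbors E v. k)" for v
    using neighbors_subset k by (intro sum.cong) auto
  then show "harmonic_on V h" using k by (simp add: harmonic_on_def)
qed

lemma card_harmonic_colorings_V:
  "card {c \<in> colorings V m. harmonic_on V (int \<circ> c)} = m"
proof -
  obtain s where s: "s \<in> V" using conn by (auto simp: connected_graph_def)
  have "bij_betw (\<lambda>k. \<lambda>v\<in>V. k) {1..m} {c \<in> colorings V m. harmonic_on V (int \<circ> c)}"
    unfolding bij_betw_def
  proof
    show "inj_on (\<lambda>k. \<lambda>v\<in>V. k) {1..m}"
      by (rule inj_onI) (metis s restrict_apply')
    show "(\<lambda>k. \<lambda>v\<in>V. k) ` {1..m} = {c \<in> colorings V m. harmonic_on V (int \<circ> c)}"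
    proof (intro equalityI subsetI)
      fix c assume "c \<in> (\<lambda>k. \<lambda>v\<in>V. k) ` {1..m}"
      then show "c \<in> {c \<in> colorings V m. harmonic_on V (int \<circ> c)}"
        by (auto simp: colorings_def harmonic_on_V_iff_constant)
    next
      fix c assume "c \<in> {c \<in> colorings V m. harmonic_on V (int \<circ> c)}"
      then have c: "c \<in> V \<rightarrow>\<^sub>E {1..m}" and "\<exists>k. \<forall>v\<in>V. int (c v) = k"
        by (auto simp: colorings_def harmonic_on_V_iff_constant)
      then have const: "c v = c s" if "v \<in> V" for v using s that by (metis of_nat_eq_iff)
      have "c = (\<lambda>v\<in>V. c s)"
      proof
        fix v show "c v = (\<lambda>v\<in>V. c s) v"
          using const[of v] PiE_arb[OF c, of v] by (cases "v \<in> V") simp_all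
      qed
      moreover have "c s \<in> {1..m}" using c s by auto
      ultimately show "c \<in> (\<lambda>k. \<lambda>v\<in>V. k) ` {1..m}" by blast
    qed
  qed
  from bij_betw_same_card[OF this] show ?thesis by simp
qed

lemma hbar_inclusion_exclusion:
  "real (hbar V E m) =
    (\<Sum>A\<in>Pow V. (-1) ^ card A * real (card {c \<in> colorings V m. harmonic_on A (int \<circ> c)}))"
proof -
  define H where "H c v \<longleftrightarrow> real (c v) = average c (neighbors E v)" for c v
  have "finite (colorings V m)" using finite_V by (simp add: colorings_def finite_PiE)
  from card_avoiding_inclusion_exclusion[OF this finite_V, of H]
  have "real (hbar V E m) = (\<Sum>A\<in>Pow V. (-1) ^ card A * real (card {c \<in> colorings V m. \<forall>v\<in>A. H c v}))"
    by (simp add: hbar_def nowhere_harmonic_def H_def)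
  also have "\<dots> = (\<Sum>A\<in>Pow V. (-1) ^ card A * real (card {c \<in> colorings V m. harmonic_on A (int \<circ> c)}))"
  proof (rule sum.cong[OF refl])
    fix A assume "A \<in> Pow V"
    then have "(\<forall>v\<in>A. H c v) \<longleftrightarrow> harmonic_on A (int \<circ> c)" for c
      using harmonic_at_iff_average unfolding H_def harmonic_on_def by auto
    then show "(-1) ^ card A * real (card {c \<in> colorings V m. \<forall>v\<in>A. H c v}) =
        (-1) ^ card A * real (card {c \<in> colorings V m. harmonic_on A (int \<circ> c)})"
      by simp
  qed
  finally show ?thesis .
qed

text \<open>What each term of the inclusion-exclusion sum has to supply.  The case \<open>A = V\<close> is exceptional at
  \<open>-1\<close>: harmonicity at one vertex follows from harmonicity at all others, so the solutions form a
  line although \<open>V - A\<close> is empty.\<close>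

definition counts_harmonic_colorings ::
    "'a set \<Rightarrow> nat \<Rightarrow> (int \<Rightarrow> real) \<Rightarrow> (nat \<Rightarrow> real poly) \<Rightarrow> bool" where
  "counts_harmonic_colorings A D g p \<longleftrightarrow> constituents g D p \<and>
    (\<forall>m. g (int m) = real (card {c \<in> colorings V m. harmonic_on A (int \<circ> c)})) \<and>
    (\<forall>j. if A = {} then p j = monom 1 (card V) else degree (p j) < card V) \<and>
    g (-1) = (if A = V then -1 else (-1) ^ card (V - A))"

text \<open>For \<open>A = V\<close> the count is the linear polynomial \<open>m\<close>, of degree less than \<open>|V|\<close> since
  \<open>|V| \<ge> 2\<close>.\<close>

lemma harmonic_colorings_quasipolynomials:
  "\<exists>D g p. \<forall>A\<in>Pow V. counts_harmonic_colorings A D (g A) (p A)"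
proof -
  obtain D where D: "D > 0" and period: "\<And>A s. A \<subset> V \<Longrightarrow> s \<in> V - A \<Longrightarrow>
      \<exists>h. harmonic_on A h \<and> h s = int D \<and> (\<forall>t\<in>V - A - {s}. h t = 0)"
    using common_extension_period by blast
  have "\<exists>g p. counts_harmonic_colorings A D g p" if sub: "A \<subseteq> V" for A
  proof -
    have Vne: "V \<noteq> {}" using two by auto
    consider "A = {}" | "A = V" | "A \<noteq> {}" "A \<subset> V" using sub by blast
    then show ?thesis
    proof cases
      case 1
      have "card {c \<in> colorings V m. harmonic_on A (int \<circ> c)} = m ^ card V" for m
        using 1 finite_V by (simp add: harmonic_on_def colorings_def card_PiE)
      then show ?thesis
        using D 1 Vne
        by (intro exI[of _ "\<lambda>m. of_int m ^ card V"] exI[of _ "\<lambda>_. monom 1 (card V)"])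
          (auto simp: counts_harmonic_colorings_def constituents_def poly_monom)
    next
      case 2
      then show ?thesis
        using D Vne two card_harmonic_colorings_V
        by (intro exI[of _ "\<lambda>m. of_int m"] exI[of _ "\<lambda>_. [:0, 1:]"])
          (auto simp: counts_harmonic_colorings_def constituents_def)
    next
      case 3
      have fin: "finite (V - A)" using finite_V by simp
      have zero: "extendable A (\<lambda>_. 0)"
        using harmonic_on_const[of A 0] by (auto simp: extendable_def)
      have "card (V - A) < card V" using 3 finite_V by (intro psubset_card_mono) auto
      moreover have "\<exists>g p. constituents g D p \<and> (\<forall>j. degree (p j) \<le> card (V - A)) \<and>
        (\<forall>m. g (int m) = real (card {u \<in> (V - A) \<rightarrow>\<^sub>E {1..m}. extendable A u})) \<and>
        g (-1) = (-1) ^ card (V - A)"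
      proof (rule card_periodic_box_quasipolynomial[where P = "extendable A", OF fin D _ zero])
        fix u u' assume "extendable A u" "\<And>s. s \<in> V - A \<Longrightarrow> [u' s = u s] (mod D)"
        then show "extendable A u'"
          using extendable_periodic[of A D u u'] period[OF 3(2)] by blast
      qed
      then obtain g p where "constituents g D p" "\<forall>j. degree (p j) \<le> card (V - A)"
        "\<forall>m. g (int m) = real (card {u \<in> (V - A) \<rightarrow>\<^sub>E {1..m}. extendable A u})"
        "g (-1) = (-1) ^ card (V - A)" by blast
      ultimately show ?thesis
        using 3 card_harmonic_colorings_eq_extendable[OF 3(2)]
        by (intro exI[of _ g] exI[of _ p]) (auto simp: counts_harmonic_colorings_def intro: le_less_trans)
    qed
  qed
  then have "\<forall>A\<in>Pow V. \<exists>g p. counts_harmonic_colorings A D g p" by blast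
  then show ?thesis by metis
qed

end

section \<open>The counting quasipolynomial\<close>

theorem theorem3p4:
  fixes V :: "'a set" and E :: "'a set set" and n :: nat
  assumes "finite_graph V E" and "connected_graph V E" and "card V = n" and "n \<ge> 2"
  shows "\<exists>f :: int \<Rightarrow> real.
           quasipolynomial f \<and> has_degree f n \<and>
           (\<forall>m\<ge>1. real (hbar V E m) = f (int m)) \<and>
           has_constant_lead_coeff f 1 \<and>
           \<bar>f (-1)\<bar> = 2 ^ n - 2"
proof -
  interpret nontrivial_connected_graph V E
    using assms by unfold_locales auto
  obtain D g p where "\<forall>A\<in>Pow V. counts_harmonic_colorings A D (g A) (p A)"
    using harmonic_colorings_quasipolynomials by blast
  then have gp: "\<forall>A\<in>Pow V. constituents (g A) D (p A) \<and>
    (\<forall>m. g A (int m) = real (card {c \<in> colorings V m. harmonic_on A (int \<circ> c)})) \<and>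
    (\<forall>j. if A = {} then p A j = monom 1 n else degree (p A j) < n) \<and>
    g A (-1) = (if A = V then -1 else (-1) ^ card (V - A))"
    unfolding counts_harmonic_colorings_def assms(3) .
  define f where "f = (\<lambda>m. \<Sum>A\<in>Pow V. (-1) ^ card A * g A m)"
  define q where "q = (\<lambda>j. \<Sum>A\<in>Pow V. smult ((-1) ^ card A) (p A j))"
  have finP: "finite (Pow V)" using finite_V by simp
  have D: "D > 0" using gp by (auto simp: constituents_def)
  have const: "constituents f D q"
    using gp by (auto simp: constituents_def f_def q_def poly_sum)
  have lead: "coeff (q j) n = 1" for j
  proof -
    have "coeff (q j) n = (\<Sum>A\<in>Pow V. if A = {} then 1 else 0)"
      unfolding q_def coeff_sum
    proof (rule sum.cong[OF refl])
      fix A assume "A \<in> Pow V"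
      then have "if A = {} then p A j = monom 1 n else degree (p A j) < n"
        using gp by blast
      then show "coeff (smult ((-1) ^ card A) (p A j)) n = (if A = {} then 1 else 0)"
        by (auto split: if_splits simp: coeff_eq_0)
    qed
    also have "\<dots> = 1" using finP by simp
    finally show ?thesis .
  qed
  have "degree (q j) \<le> n" for j
    unfolding q_def
  proof (rule degree_sum_le[OF finP])
    fix A assume "A \<in> Pow V"
    then have "if A = {} then p A j = monom 1 n else degree (p A j) < n"
      using gp by blast
    then show "degree (smult ((-1) ^ card A) (p A j)) \<le> n"
      by (auto split: if_splits simp: degree_monom_eq)
  qed
  then have deg: "degree (q j) = n" for j
    using lead[of j] by (metis le_antisym le_degree zero_neq_one)
  have maxdeg: "max_degree D q = n"
    using D by (simp add: max_degree_def deg image_constant_conv)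
  have sign: "(-1) ^ card A * g A (-1) = (-1) ^ n * (1 - (if A = V then 2 else 0))"
    if "A \<in> Pow V" for A
  proof -
    have "card A + card (V - A) = n"
      using that assms(3) finite_V card_mono[of V A]
      by (simp add: card_Diff_subset finite_subset)
    then have "(-1 :: real) ^ card A * (-1) ^ card (V - A) = (-1) ^ n"
      by (metis power_add)
    then show ?thesis using gp that assms(3) by auto
  qed
  have "f (-1) = (\<Sum>A\<in>Pow V. (-1) ^ n * (1 - (if A = V then 2 else 0)))"
    unfolding f_def by (rule sum.cong[OF refl sign])
  also have "\<dots> = (-1) ^ n * (2 ^ n - 2)"
    unfolding sum_distrib_left[symmetric] sum_subtractf
    using finP finite_V assms(3) by (simp add: card_Pow)
  finally have "\<bar>f (-1)\<bar> = \<bar>2 ^ n - 2\<bar>" by (simp add: abs_mult power_abs)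
  moreover have "(2::real) ^ 1 \<le> 2 ^ n" using assms(4) by (intro power_increasing) auto
  ultimately have "\<bar>f (-1)\<bar> = 2 ^ n - 2" by simp
  moreover have "\<forall>m\<ge>1. real (hbar V E m) = f (int m)"
    using gp by (simp add: hbar_inclusion_exclusion f_def)
  moreover have "quasipolynomial f" using const by (auto simp: quasipolynomial_def)
  moreover have "has_degree f n" using const maxdeg by (auto simp: has_degree_def)
  moreover have "has_constant_lead_coeff f 1"
    unfolding has_constant_lead_coeff_def using const maxdeg lead by metis
  ultimately show ?thesis by blast
qed

end
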